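(* Let $M$ be an infinite pointed metric space with basepoint $0$. Suppose that there are $\overline{x}\in M$ and $\varepsilon>0$ such that the closed ball $\overline{B}(\overline{x},\varepsilon)$ is compact. Then, for every Lipschitz map $f\colon M\to M$ with $f(0)=0$, the operator $\widehat f\colon \mathcal F(M)\to\mathcal F(M)$ has a non-trivial invariant subspace.
   Context: $\mathbb K$ denotes $\mathbb R$ or $\mathbb C$. For a metric space $M$ with basepoint $0$, $\mathrm{Lip}_0(M)$ is the Banach space of Lipschitz functions $\varphi\colon M\to\mathbb K$ with $\varphi(0)=0$, normed by the best Lipschitz constant. For $x\in M$, $\delta(x)\in \mathrm{Lip}_0(M)^*$ is the evaluation functional $\varphi\mapsto\varphi(x)$. The Lipschitz-free space is $\mathcal F(M):=\overline{\mathrm{span}}\{\delta(x):x\in M\}\subset \mathrm{Lip}_0(M)^*$ (norm closure). For a Lipschitz map $f\colon M\to M$ with $f(0)=0$, $\widehat f\colon\mathcal F(M)\to\mathcal F(M)$ is the unique bounded linear operator with $\widehat f(\delta(x))=\delta(f(x))$ for all $x\in M$. A non-trivial invariant subspace of a bounded operator $T\colon X\to X$ is a closed linear subspace $S$ with $\{0\}\subsetneq S\subsetneq X$ and $T(S)\subset S$. Here $\overline{B}(x,r)=\{y\in M: d(x,y)\le r\}$. *)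

theory Defs
  imports "HOL-Analysis.Analysis"
begin

text \<open>
  A pointed metric space is a type of sort \<open>{metric_space, zero}\<close>: the class \<open>zero\<close> has no
  axioms, so \<open>0\<close> is an arbitrary distinguished point. The scalar field is a type variable
  \<open>'k\<close> of class \<open>real_normed_field\<close>, to be instantiated with \<open>real\<close> or \<open>complex\<close>. The library's
  \<open>subspace\<close>, \<open>span\<close>, \<open>linear\<close> are over the reals, hence over \<open>'k\<close> we use the locale constants
  \<open>module.subspace\<close>, \<open>module.span\<close>, \<open>Vector_Spaces.linear\<close> with explicit scalar multiplications.
\<close>

section \<open>The space of Lipschitz functions vanishing at the base point\<close>

typedef (overloaded) ('a, 'k) lip0 =
  "{\<phi> :: 'a::{metric_space,zero} \<Rightarrow> 'k::real_normed_field. \<phi> 0 = 0 \<and> (\<exists>L. L-lipschitz_on UNIV \<phi>)}"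
  morphisms lip0_apply Lip0
  by (rule exI[of _ "\<lambda>_. 0"]) (auto intro: lipschitz_on_constant)

setup_lifting type_definition_lip0

lemma lip0_eqI: "(\<And>x. lip0_apply \<phi> x = lip0_apply \<psi> x) \<Longrightarrow> \<phi> = \<psi>"
  by transfer auto

lemma lipschitz_on_scalar_mult:
  fixes \<phi> :: "'a::metric_space \<Rightarrow> 'k::real_normed_field"
  assumes "L-lipschitz_on U \<phi>"
  shows "(norm c * L)-lipschitz_on U (\<lambda>x. c * \<phi> x)"
proof (rule lipschitz_onI)
  fix x y assume "x \<in> U" "y \<in> U"
  then have "dist (\<phi> x) (\<phi> y) \<le> L * dist x y" using assms by (auto simp: lipschitz_on_def)
  then have "norm c * dist (\<phi> x) (\<phi> y) \<le> norm c * (L * dist x y)" by (intro mult_left_mono) auto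
  then show "dist (c * \<phi> x) (c * \<phi> y) \<le> norm c * L * dist x y"
    by (simp add: dist_norm norm_mult mult.assoc flip: right_diff_distrib)
qed (use lipschitz_on_nonneg[OF assms] in simp)

lift_definition lip0_scale :: "'k::real_normed_field \<Rightarrow> ('a::{metric_space,zero}, 'k) lip0 \<Rightarrow> ('a, 'k) lip0"
  is "\<lambda>c \<phi> x. c * \<phi> x"
  by (auto intro: lipschitz_on_scalar_mult)

instantiation lip0 :: ("{metric_space,zero}", real_normed_field) real_normed_vector
begin

lift_definition zero_lip0 :: "('a, 'b) lip0" is "\<lambda>_. 0"
  by (auto intro: lipschitz_on_constant)

lift_definition plus_lip0 :: "('a, 'b) lip0 \<Rightarrow> ('a, 'b) lip0 \<Rightarrow> ('a, 'b) lip0" is "\<lambda>\<phi> \<psi> x. \<phi> x + \<psi> x"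
  by (auto intro: lipschitz_on_add)

lift_definition uminus_lip0 :: "('a, 'b) lip0 \<Rightarrow> ('a, 'b) lip0" is "\<lambda>\<phi> x. - \<phi> x"
  by auto

lift_definition minus_lip0 :: "('a, 'b) lip0 \<Rightarrow> ('a, 'b) lip0 \<Rightarrow> ('a, 'b) lip0" is "\<lambda>\<phi> \<psi> x. \<phi> x - \<psi> x"
  by (auto intro: lipschitz_on_diff)

lift_definition scaleR_lip0 :: "real \<Rightarrow> ('a, 'b) lip0 \<Rightarrow> ('a, 'b) lip0" is "\<lambda>r \<phi> x. r *\<^sub>R \<phi> x"
  by (auto intro: lipschitz_on_cmult)

text \<open>The best Lipschitz constant; \<open>L-lipschitz_on U \<phi>\<close> includes \<open>0 \<le> L\<close>.\<close>

definition norm_lip0 :: "('a, 'b) lip0 \<Rightarrow> real" where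
  "norm_lip0 \<phi> = Inf {L. L-lipschitz_on UNIV (lip0_apply \<phi>)}"

definition dist_lip0 :: "('a, 'b) lip0 \<Rightarrow> ('a, 'b) lip0 \<Rightarrow> real" where
  "dist_lip0 \<phi> \<psi> = norm (\<phi> - \<psi>)"

definition sgn_lip0 :: "('a, 'b) lip0 \<Rightarrow> ('a, 'b) lip0" where
  "sgn_lip0 \<phi> = inverse (norm \<phi>) *\<^sub>R \<phi>"

definition uniformity_lip0 :: "(('a, 'b) lip0 \<times> ('a, 'b) lip0) filter" where
  "uniformity_lip0 = (INF e\<in>{0<..}. principal {(\<phi>, \<psi>). dist \<phi> \<psi> < e})"

definition open_lip0 :: "('a, 'b) lip0 set \<Rightarrow> bool" where
  "open_lip0 S = (\<forall>\<phi>\<in>S. \<forall>\<^sub>F (\<phi>', \<psi>) in uniformity. \<phi>' = \<phi> \<longrightarrow> \<psi> \<in> S)"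

lemma lip0_norm_le: "L-lipschitz_on UNIV (lip0_apply \<phi>) \<Longrightarrow> norm \<phi> \<le> L"
  unfolding norm_lip0_def
  by (rule cInf_lower) (auto intro!: bdd_belowI[of _ 0] lipschitz_on_nonneg)

lemma lip0_lipschitz: "(norm \<phi>)-lipschitz_on UNIV (lip0_apply \<phi>)"
proof -
  let ?S = "{L. L-lipschitz_on UNIV (lip0_apply \<phi>)}"
  have ne: "?S \<noteq> {}" using lip0_apply[of \<phi>] by auto
  show ?thesis
  proof (rule lipschitz_onI)
    show "0 \<le> norm \<phi>" unfolding norm_lip0_def
      by (rule cInf_greatest[OF ne]) (auto intro: lipschitz_on_nonneg)
    fix x y :: 'a
    show "dist (lip0_apply \<phi> x) (lip0_apply \<phi> y) \<le> norm \<phi> * dist x y"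
    proof (cases "x = y")
      case False
      then have "dist x y > 0" by simp
      then have "dist (lip0_apply \<phi> x) (lip0_apply \<phi> y) / dist x y \<le> norm \<phi>" unfolding norm_lip0_def
        by (intro cInf_greatest[OF ne]) (auto simp: lipschitz_on_def pos_divide_le_eq)
      then show ?thesis using \<open>dist x y > 0\<close> by (simp add: pos_divide_le_eq)
    qed simp
  qed
qed

lemma lip0_norm_nonneg: "0 \<le> norm (\<phi> :: ('a, 'b) lip0)"
  using lip0_lipschitz lipschitz_on_nonneg by blast

lemma lip0_apply_0 [simp]: "lip0_apply \<phi> 0 = 0"
  using lip0_apply[of \<phi>] by auto

lemma norm_lip0_apply_le: "norm (lip0_apply \<phi> x) \<le> norm \<phi> * dist x 0"
  using lipschitz_onD[OF lip0_lipschitz, of x 0 \<phi>] by simp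

lemma lip0_norm_scaleR_le: "norm (r *\<^sub>R \<phi>) \<le> \<bar>r\<bar> * norm (\<phi> :: ('a, 'b) lip0)"
  by (rule lip0_norm_le) (auto simp: scaleR_lip0.rep_eq intro: lipschitz_on_cmult lip0_lipschitz)

instance
proof
  fix \<phi> \<psi> \<theta> :: "('a, 'b) lip0" and r s :: real
  show "\<phi> + \<psi> + \<theta> = \<phi> + (\<psi> + \<theta>)" by transfer (simp add: add.assoc)
  show "\<phi> + \<psi> = \<psi> + \<phi>" by transfer (simp add: add.commute)
  show "0 + \<phi> = \<phi>" by transfer simp
  show "- \<phi> + \<phi> = 0" by transfer simp
  show "\<phi> - \<psi> = \<phi> + - \<psi>" by transfer simp
  show "r *\<^sub>R (\<phi> + \<psi>) = r *\<^sub>R \<phi> + r *\<^sub>R \<psi>" by transfer (simp add: scaleR_add_right)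
  show "(r + s) *\<^sub>R \<phi> = r *\<^sub>R \<phi> + s *\<^sub>R \<phi>" by transfer (simp add: scaleR_add_left)
  show "r *\<^sub>R s *\<^sub>R \<phi> = (r * s) *\<^sub>R \<phi>" by transfer simp
  show one: "1 *\<^sub>R \<phi> = \<phi>" for \<phi> :: "('a, 'b) lip0" by transfer simp
  show "dist \<phi> \<psi> = norm (\<phi> - \<psi>)" by (rule dist_lip0_def)
  show "sgn \<phi> = inverse (norm \<phi>) *\<^sub>R \<phi>" by (simp add: sgn_lip0_def)
  show "uniformity = (INF e\<in>{0<..}. principal {(\<phi>, \<psi> :: ('a, 'b) lip0). dist \<phi> \<psi> < e})"
    by (rule uniformity_lip0_def)
  show "open U = (\<forall>\<phi>\<in>U. \<forall>\<^sub>F (\<phi>', \<psi>) in uniformity. \<phi>' = \<phi> \<longrightarrow> \<psi> \<in> U)"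
    for U :: "('a, 'b) lip0 set" by (rule open_lip0_def)
  have zero: "norm (0 :: ('a, 'b) lip0) = 0"
    by (rule antisym[OF lip0_norm_le lip0_norm_nonneg]) (simp add: zero_lip0.rep_eq lipschitz_on_constant)
  show "norm \<phi> = 0 \<longleftrightarrow> \<phi> = 0"
  proof
    assume "norm \<phi> = 0"
    then have "lip0_apply \<phi> x = 0" for x using norm_lip0_apply_le[of \<phi> x] by simp
    then show "\<phi> = 0" by (intro lip0_eqI) (simp add: zero_lip0.rep_eq)
  qed (simp add: zero)
  show "norm (\<phi> + \<psi>) \<le> norm \<phi> + norm \<psi>"
    by (rule lip0_norm_le) (auto simp: plus_lip0.rep_eq intro: lipschitz_on_add lip0_lipschitz)
  show "norm (r *\<^sub>R \<phi>) = \<bar>r\<bar> * norm \<phi>"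
  proof (cases "r = 0")
    case True
    then have "r *\<^sub>R \<phi> = 0" by transfer simp
    then show ?thesis using True zero by simp
  next
    case False
    have "inverse r *\<^sub>R r *\<^sub>R \<phi> = \<phi>" using False by transfer simp
    then have "norm \<phi> \<le> \<bar>inverse r\<bar> * norm (r *\<^sub>R \<phi>)"
      using lip0_norm_scaleR_le[of "inverse r" "r *\<^sub>R \<phi>"] by simp
    then have "\<bar>r\<bar> * norm \<phi> \<le> norm (r *\<^sub>R \<phi>)"
      using False by (simp add: field_simps)
    then show ?thesis using lip0_norm_scaleR_le[of r \<phi>] by linarith
  qed
qed

end

section \<open>The dual space and the evaluation functionals\<close>

text \<open>
  The dual consists of the \<open>'k\<close>-linear elements of the space of bounded real-linear maps to \<open>'k\<close>;
  the norm of \<open>\<Rightarrow>\<^sub>L\<close> is the operator norm.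
\<close>

definition lip0_dual :: "(('a::{metric_space,zero}, 'k::real_normed_field) lip0 \<Rightarrow>\<^sub>L 'k) set" where
  "lip0_dual = {\<Lambda>. Vector_Spaces.linear lip0_scale (*) (blinfun_apply \<Lambda>)}"

definition functional_scale ::
  "'k::real_normed_field \<Rightarrow> ('v::real_normed_vector \<Rightarrow>\<^sub>L 'k) \<Rightarrow> ('v \<Rightarrow>\<^sub>L 'k)" where
  "functional_scale c \<Lambda> = blinfun_mult_right c o\<^sub>L \<Lambda>"

lemma functional_scale_apply [simp]: "blinfun_apply (functional_scale c \<Lambda>) \<phi> = c * blinfun_apply \<Lambda> \<phi>"
  by (simp add: functional_scale_def)

lift_definition lip0_eval :: "'a::{metric_space,zero} \<Rightarrow> ('a, 'k::real_normed_field) lip0 \<Rightarrow>\<^sub>L 'k"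
  is "\<lambda>x \<phi>. lip0_apply \<phi> x"
proof (rule bounded_linear_intro)
  fix x :: 'a and \<phi> \<psi> :: "('a, 'k) lip0" and r :: real
  show "lip0_apply (\<phi> + \<psi>) x = lip0_apply \<phi> x + lip0_apply \<psi> x" by (simp add: plus_lip0.rep_eq)
  show "lip0_apply (r *\<^sub>R \<phi>) x = r *\<^sub>R lip0_apply \<phi> x" by (simp add: scaleR_lip0.rep_eq)
  show "norm (lip0_apply \<phi> x) \<le> norm \<phi> * dist x 0" by (rule norm_lip0_apply_le)
qed

interpretation lip0: vector_space
  "lip0_scale :: 'k::real_normed_field \<Rightarrow> ('a::{metric_space,zero}, 'k) lip0 \<Rightarrow> ('a, 'k) lip0"
  by unfold_locales (transfer; simp add: algebra_simps)+

interpretation functional: vector_space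
  "functional_scale :: 'k::real_normed_field \<Rightarrow> ('v::real_normed_vector \<Rightarrow>\<^sub>L 'k) \<Rightarrow> ('v \<Rightarrow>\<^sub>L 'k)"
  by unfold_locales (auto intro!: blinfun_eqI simp: blinfun.bilinear_simps algebra_simps)

lemma bounded_linear_functional_scale: "bounded_linear (functional_scale c)"
  unfolding functional_scale_def by (intro bounded_linear_intros)

lemma functional_scale_of_real: "functional_scale (of_real r) \<Lambda> = r *\<^sub>R \<Lambda>"
  by (rule blinfun_eqI) (simp add: blinfun.bilinear_simps scaleR_conv_of_real)

lemma functional_subspace_closure:
  assumes "functional.subspace S"
  shows "functional.subspace (closure S)"
proof (rule functional.subspaceI)
  show "0 \<in> closure S" using functional.subspace_0[OF assms] closure_subset by blast
next
  fix x y assume "x \<in> closure S" "y \<in> closure S"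
  then obtain u v where u: "\<And>n. u n \<in> S" "u \<longlonglongrightarrow> x" and v: "\<And>n. v n \<in> S" "v \<longlonglongrightarrow> y"
    unfolding closure_sequential by auto
  have "(\<lambda>n. u n + v n) \<longlonglongrightarrow> x + y" by (intro tendsto_add u v)
  moreover have "\<And>n. u n + v n \<in> S" using u v functional.subspace_add[OF assms] by auto
  ultimately show "x + y \<in> closure S"
    unfolding closure_sequential by (intro exI[of _ "\<lambda>n. u n + v n"]) auto
next
  fix c x assume "x \<in> closure S"
  then obtain u where u: "\<And>n. u n \<in> S" "u \<longlonglongrightarrow> x"
    unfolding closure_sequential by auto
  have "(\<lambda>n. functional_scale c (u n)) \<longlonglongrightarrow> functional_scale c x"
    by (intro bounded_linear.tendsto[OF bounded_linear_functional_scale] u)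
  moreover have "\<And>n. functional_scale c (u n) \<in> S" using u functional.subspace_scale[OF assms] by auto
  ultimately show "functional_scale c x \<in> closure S"
    unfolding closure_sequential by (intro exI[of _ "\<lambda>n. functional_scale c (u n)"]) auto
qed

section \<open>The Lipschitz-free space\<close>

definition lip_free_set :: "(('a::{metric_space,zero}, 'k::real_normed_field) lip0 \<Rightarrow>\<^sub>L 'k) set" where
  "lip_free_set = closure (module.span functional_scale (range lip0_eval))"

lemma subspace_lip_free_set: "functional.subspace lip_free_set"
  unfolding lip_free_set_def by (intro functional_subspace_closure functional.subspace_span)

lemma lip0_dual_iff:
  "\<Lambda> \<in> lip0_dual \<longleftrightarrow> (\<forall>c \<phi>. blinfun_apply \<Lambda> (lip0_scale c \<phi>) = c * blinfun_apply \<Lambda> \<phi>)"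
proof
  assume "\<Lambda> \<in> lip0_dual"
  then interpret l: Vector_Spaces.linear lip0_scale "(*)" "blinfun_apply \<Lambda>" by (simp add: lip0_dual_def)
  show "\<forall>c \<phi>. blinfun_apply \<Lambda> (lip0_scale c \<phi>) = c * blinfun_apply \<Lambda> \<phi>" by (simp add: l.scale)
next
  assume "\<forall>c \<phi>. blinfun_apply \<Lambda> (lip0_scale c \<phi>) = c * blinfun_apply \<Lambda> \<phi>"
  then show "\<Lambda> \<in> lip0_dual"
    unfolding lip0_dual_def mem_Collect_eq
    by unfold_locales (auto simp: blinfun.add_right algebra_simps)
qed

text \<open>
  Taking the closure in the space of all bounded real-linear maps is the same as taking it in the dual:
\<close>

lemma closed_lip0_dual: "closed lip0_dual"
proof -
  have "lip0_dual = (\<Inter>c. \<Inter>\<phi>. {\<Lambda>. blinfun_apply \<Lambda> (lip0_scale c \<phi>) = c * blinfun_apply \<Lambda> \<phi>})"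
    by (auto simp: lip0_dual_iff)
  also have "closed \<dots>"
    by (intro closed_INT ballI closed_Collect_eq continuous_intros)
  finally show ?thesis .
qed

lemma lip_free_set_subset_dual: "lip_free_set \<subseteq> lip0_dual"
proof -
  have "functional.subspace lip0_dual"
    by (rule functional.subspaceI) (auto simp: lip0_dual_iff blinfun.bilinear_simps algebra_simps)
  moreover have "range lip0_eval \<subseteq> lip0_dual"
    by (auto simp: lip0_dual_iff lip0_eval.rep_eq lip0_scale.rep_eq)
  ultimately show ?thesis unfolding lip_free_set_def
    by (intro closure_minimal functional.span_minimal closed_lip0_dual)
qed

typedef (overloaded) ('a, 'k) lip_free =
  "lip_free_set :: (('a::{metric_space,zero}, 'k::real_normed_field) lip0 \<Rightarrow>\<^sub>L 'k) set"
  using functional.subspace_0[OF subspace_lip_free_set] by blast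

setup_lifting type_definition_lip_free

lift_definition lip_free_scale ::
  "'k::real_normed_field \<Rightarrow> ('a::{metric_space,zero}, 'k) lip_free \<Rightarrow> ('a, 'k) lip_free"
  is functional_scale
  by (rule functional.subspace_scale[OF subspace_lip_free_set])

instantiation lip_free :: ("{metric_space,zero}", real_normed_field) real_normed_vector
begin

lift_definition zero_lip_free :: "('a, 'b) lip_free" is 0
  by (rule functional.subspace_0[OF subspace_lip_free_set])

lift_definition plus_lip_free :: "('a, 'b) lip_free \<Rightarrow> ('a, 'b) lip_free \<Rightarrow> ('a, 'b) lip_free" is "(+)"
  by (rule functional.subspace_add[OF subspace_lip_free_set])

lift_definition uminus_lip_free :: "('a, 'b) lip_free \<Rightarrow> ('a, 'b) lip_free" is uminus
  by (rule functional.subspace_neg[OF subspace_lip_free_set])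

lift_definition minus_lip_free :: "('a, 'b) lip_free \<Rightarrow> ('a, 'b) lip_free \<Rightarrow> ('a, 'b) lip_free" is "(-)"
  by (rule functional.subspace_diff[OF subspace_lip_free_set])

lift_definition scaleR_lip_free :: "real \<Rightarrow> ('a, 'b) lip_free \<Rightarrow> ('a, 'b) lip_free" is "(*\<^sub>R)"
  using functional.subspace_scale[OF subspace_lip_free_set] functional_scale_of_real by metis

lift_definition norm_lip_free :: "('a, 'b) lip_free \<Rightarrow> real" is norm .

lift_definition dist_lip_free :: "('a, 'b) lip_free \<Rightarrow> ('a, 'b) lip_free \<Rightarrow> real" is dist .

definition sgn_lip_free :: "('a, 'b) lip_free \<Rightarrow> ('a, 'b) lip_free" where
  "sgn_lip_free \<mu> = inverse (norm \<mu>) *\<^sub>R \<mu>"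

definition uniformity_lip_free :: "(('a, 'b) lip_free \<times> ('a, 'b) lip_free) filter" where
  "uniformity_lip_free = (INF e\<in>{0<..}. principal {(\<mu>, \<nu>). dist \<mu> \<nu> < e})"

definition open_lip_free :: "('a, 'b) lip_free set \<Rightarrow> bool" where
  "open_lip_free S = (\<forall>\<mu>\<in>S. \<forall>\<^sub>F (\<mu>', \<nu>) in uniformity. \<mu>' = \<mu> \<longrightarrow> \<nu> \<in> S)"

instance
proof
  fix \<mu> \<nu> \<rho> :: "('a, 'b) lip_free" and r s :: real
  show "\<mu> + \<nu> + \<rho> = \<mu> + (\<nu> + \<rho>)" by transfer (simp add: add.assoc)
  show "\<mu> + \<nu> = \<nu> + \<mu>" by transfer (simp add: add.commute)
  show "0 + \<mu> = \<mu>" by transfer simp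
  show "- \<mu> + \<mu> = 0" by transfer simp
  show "\<mu> - \<nu> = \<mu> + - \<nu>" by transfer simp
  show "r *\<^sub>R (\<mu> + \<nu>) = r *\<^sub>R \<mu> + r *\<^sub>R \<nu>" by transfer (simp add: scaleR_add_right)
  show "(r + s) *\<^sub>R \<mu> = r *\<^sub>R \<mu> + s *\<^sub>R \<mu>" by transfer (simp add: scaleR_add_left)
  show "r *\<^sub>R s *\<^sub>R \<mu> = (r * s) *\<^sub>R \<mu>" by transfer simp
  show "1 *\<^sub>R \<mu> = \<mu>" by transfer simp
  show "dist \<mu> \<nu> = norm (\<mu> - \<nu>)" by transfer (rule dist_norm)
  show "sgn \<mu> = inverse (norm \<mu>) *\<^sub>R \<mu>" by (simp add: sgn_lip_free_def)
  show "uniformity = (INF e\<in>{0<..}. principal {(\<mu>, \<nu> :: ('a, 'b) lip_free). dist \<mu> \<nu> < e})"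
    by (rule uniformity_lip_free_def)
  show "open U = (\<forall>\<mu>\<in>U. \<forall>\<^sub>F (\<mu>', \<nu>) in uniformity. \<mu>' = \<mu> \<longrightarrow> \<nu> \<in> U)"
    for U :: "('a, 'b) lip_free set" by (rule open_lip_free_def)
  show "norm \<mu> = 0 \<longleftrightarrow> \<mu> = 0" by transfer simp
  show "norm (\<mu> + \<nu>) \<le> norm \<mu> + norm \<nu>" by transfer (rule norm_triangle_ineq)
  show "norm (r *\<^sub>R \<mu>) = \<bar>r\<bar> * norm \<mu>" by transfer simp
qed

end

interpretation lip_free: vector_space
  "lip_free_scale :: 'k::real_normed_field \<Rightarrow> ('a::{metric_space,zero}, 'k) lip_free \<Rightarrow> ('a, 'k) lip_free"
  by unfold_locales
    (transfer; simp add: functional.scale_right_distrib functional.scale_left_distrib)+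

lift_definition lip_free_delta :: "'a::{metric_space,zero} \<Rightarrow> ('a, 'k::real_normed_field) lip_free"
  is lip0_eval
  unfolding lip_free_set_def by (intro closure_subset[THEN subsetD] functional.span_base rangeI)

section \<open>The linearization of a Lipschitz map\<close>

definition lip_free_map ::
  "('a::{metric_space,zero} \<Rightarrow> 'a) \<Rightarrow> ('a, 'k::real_normed_field) lip_free \<Rightarrow>\<^sub>L ('a, 'k) lip_free" where
  "lip_free_map f = (THE T. Vector_Spaces.linear lip_free_scale lip_free_scale (blinfun_apply T) \<and>
     (\<forall>x. blinfun_apply T (lip_free_delta x) = lip_free_delta (f x)))"

lemma lip_free_map_unique:
  fixes T T' :: "('a::{metric_space,zero}, 'k::real_normed_field) lip_free \<Rightarrow>\<^sub>L ('a, 'k) lip_free"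
  assumes T: "Vector_Spaces.linear lip_free_scale lip_free_scale (blinfun_apply T)"
    and T': "Vector_Spaces.linear lip_free_scale lip_free_scale (blinfun_apply T')"
    and eq: "\<And>x. blinfun_apply T (lip_free_delta x) = blinfun_apply T' (lip_free_delta x)"
  shows "T = T'"
proof (rule blinfun_eqI)
  fix \<mu> :: "('a, 'k) lip_free"
  interpret T: Vector_Spaces.linear lip_free_scale lip_free_scale "blinfun_apply T" by fact
  interpret T': Vector_Spaces.linear lip_free_scale lip_free_scale "blinfun_apply T'" by fact
  let ?E = "{\<Lambda>. \<exists>\<nu>. Rep_lip_free \<nu> = \<Lambda> \<and> blinfun_apply T \<nu> = blinfun_apply T' \<nu>}"
  have sub: "functional.span (range lip0_eval) \<subseteq> ?E"
  proof (rule functional.span_minimal)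
    show "range lip0_eval \<subseteq> ?E" using eq lip_free_delta.rep_eq by blast
    show "functional.subspace ?E"
    proof (rule functional.subspaceI)
      show "0 \<in> ?E" by (auto intro!: exI[of _ 0] simp: zero_lip_free.rep_eq)
    next
      fix x y assume "x \<in> ?E" "y \<in> ?E"
      then obtain v w where "Rep_lip_free v = x" "Rep_lip_free w = y"
        "blinfun_apply T v = blinfun_apply T' v" "blinfun_apply T w = blinfun_apply T' w" by auto
      then show "x + y \<in> ?E"
        by (auto intro!: exI[of _ "v + w"] simp: plus_lip_free.rep_eq blinfun.add_right)
    next
      fix c x assume "x \<in> ?E"
      then obtain v where "Rep_lip_free v = x" "blinfun_apply T v = blinfun_apply T' v" by auto
      then show "functional_scale c x \<in> ?E"
        by (auto intro!: exI[of _ "lip_free_scale c v"] simp: lip_free_scale.rep_eq T.scale T'.scale)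
    qed
  qed
  have "Rep_lip_free \<mu> \<in> closure (functional.span (range lip0_eval))"
    using Rep_lip_free[of \<mu>] by (simp add: lip_free_set_def)
  then obtain u where u: "\<And>n. u n \<in> functional.span (range lip0_eval)" "u \<longlonglongrightarrow> Rep_lip_free \<mu>"
    unfolding closure_sequential by auto
  then have "\<forall>n. \<exists>\<nu>. Rep_lip_free \<nu> = u n \<and> blinfun_apply T \<nu> = blinfun_apply T' \<nu>" using sub by blast
  then obtain v where v: "\<And>n. Rep_lip_free (v n) = u n"
    "\<And>n. blinfun_apply T (v n) = blinfun_apply T' (v n)" by metis
  have lim: "v \<longlonglongrightarrow> \<mu>"
    using u(2) unfolding tendsto_iff by (simp add: dist_lip_free.rep_eq v)
  have "(\<lambda>n. blinfun_apply T (v n)) \<longlonglongrightarrow> blinfun_apply T \<mu>" by (intro tendsto_intros lim)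
  moreover have "(\<lambda>n. blinfun_apply T (v n)) \<longlonglongrightarrow> blinfun_apply T' \<mu>"
    unfolding v(2) by (intro tendsto_intros lim)
  ultimately show "blinfun_apply T \<mu> = blinfun_apply T' \<mu>" by (rule LIMSEQ_unique)
qed

lemma lip_free_map_exists:
  fixes f :: "'a::{metric_space,zero} \<Rightarrow> 'a"
  assumes f: "L-lipschitz_on UNIV f" and f0: "f 0 = 0"
  shows "\<exists>T :: ('a, 'k::real_normed_field) lip_free \<Rightarrow>\<^sub>L ('a, 'k) lip_free.
    Vector_Spaces.linear lip_free_scale lip_free_scale (blinfun_apply T) \<and>
    (\<forall>x. blinfun_apply T (lip_free_delta x) = lip_free_delta (f x))"
proof -
  define C :: "('a, 'k) lip0 \<Rightarrow> ('a, 'k) lip0" where "C \<phi> = Lip0 (lip0_apply \<phi> \<circ> f)" for \<phi>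
  have lip: "(norm \<phi> * L)-lipschitz_on UNIV (lip0_apply \<phi> \<circ> f)" for \<phi> :: "('a, 'k) lip0"
    by (intro lipschitz_on_compose f lipschitz_on_subset[OF lip0_lipschitz]) auto
  have C: "lip0_apply (C \<phi>) x = lip0_apply \<phi> (f x)" for \<phi> x
    unfolding C_def using lip[of \<phi>] by (subst Lip0_inverse) (auto simp: f0)
  have "bounded_linear C"
  proof (rule bounded_linear_intro)
    show "norm (C \<phi>) \<le> norm \<phi> * L" for \<phi>
      using lip[of \<phi>] by (intro lip0_norm_le) (simp add: C comp_def cong: lipschitz_on_cong)
  qed (auto intro!: lip0_eqI simp: C plus_lip0.rep_eq scaleR_lip0.rep_eq)
  then have CB: "blinfun_apply (Blinfun C) \<phi> = C \<phi>" for \<phi> by (simp add: bounded_linear_Blinfun_apply)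
  define D :: "(('a, 'k) lip0 \<Rightarrow>\<^sub>L 'k) \<Rightarrow> (('a, 'k) lip0 \<Rightarrow>\<^sub>L 'k)" where "D \<Lambda> = \<Lambda> o\<^sub>L Blinfun C" for \<Lambda>
  have D_bl: "bounded_linear D" unfolding D_def by (intro bounded_linear_intros)
  then interpret D: bounded_linear D .
  have D_scale: "D (functional_scale c \<Lambda>) = functional_scale c (D \<Lambda>)" for c \<Lambda>
    by (rule blinfun_eqI) (simp add: D_def)
  have D_eval: "D (lip0_eval x) = lip0_eval (f x)" for x
    by (rule blinfun_eqI) (simp add: D_def CB C lip0_eval.rep_eq)
  let ?S = "functional.span (range lip0_eval) :: (('a, 'k) lip0 \<Rightarrow>\<^sub>L 'k) set"
  have "functional.subspace {\<Lambda>. D \<Lambda> \<in> ?S}"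
    by (rule functional.subspaceI)
      (auto simp: D.zero D.add D_scale functional.span_zero functional.span_add functional.span_scale)
  then have "?S \<subseteq> {\<Lambda>. D \<Lambda> \<in> ?S}"
    by (intro functional.span_minimal) (auto simp: D_eval functional.span_base)
  then have DS: "D ` ?S \<subseteq> ?S" by auto
  have Dcl: "D \<Lambda> \<in> lip_free_set" if "\<Lambda> \<in> lip_free_set" for \<Lambda>
  proof -
    have "D ` closure ?S \<subseteq> closure ?S"
      by (rule image_closure_subset)
        (use DS closure_subset in \<open>auto intro!: linear_continuous_on D_bl\<close>)
    then show ?thesis using that by (auto simp: lip_free_set_def)
  qed
  define T :: "('a, 'k) lip_free \<Rightarrow> ('a, 'k) lip_free" where
    "T \<mu> = Abs_lip_free (D (Rep_lip_free \<mu>))" for \<mu>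
  have RT: "Rep_lip_free (T \<mu>) = D (Rep_lip_free \<mu>)" for \<mu>
    unfolding T_def by (intro Abs_lip_free_inverse Dcl Rep_lip_free)
  obtain K where K: "\<And>\<Lambda>. norm (D \<Lambda>) \<le> norm \<Lambda> * K" using D.bounded by blast
  have "bounded_linear T"
    by (rule bounded_linear_intro[of _ K])
      (auto simp: Rep_lip_free_inject[symmetric] RT plus_lip_free.rep_eq scaleR_lip_free.rep_eq
        norm_lip_free.rep_eq D.add D.scaleR K)
  then have TB: "blinfun_apply (Blinfun T) = T" by (rule bounded_linear_Blinfun_apply)
  have "Vector_Spaces.linear lip_free_scale lip_free_scale T"
    by unfold_locales
      (auto simp: Rep_lip_free_inject[symmetric] RT plus_lip_free.rep_eq lip_free_scale.rep_eq D.add D_scale)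
  moreover have "T (lip_free_delta x) = lip_free_delta (f x)" for x
    by (simp add: Rep_lip_free_inject[symmetric] RT lip_free_delta.rep_eq D_eval)
  ultimately show ?thesis by (intro exI[of _ "Blinfun T"]) (simp add: TB)
qed

text \<open>The definite description in \<open>lip_free_map\<close> is justified:\<close>

lemma lip_free_map:
  fixes f :: "'a::{metric_space,zero} \<Rightarrow> 'a"
  assumes "\<exists>L. L-lipschitz_on UNIV f" and "f 0 = 0"
  defines "T \<equiv> lip_free_map f :: ('a, 'k::real_normed_field) lip_free \<Rightarrow>\<^sub>L ('a, 'k) lip_free"
  shows "Vector_Spaces.linear lip_free_scale lip_free_scale (blinfun_apply T)"
    and "blinfun_apply T (lip_free_delta x) = lip_free_delta (f x)"
proof -
  have "\<exists>!T :: ('a, 'k) lip_free \<Rightarrow>\<^sub>L ('a, 'k) lip_free.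
    Vector_Spaces.linear lip_free_scale lip_free_scale (blinfun_apply T) \<and>
    (\<forall>x. blinfun_apply T (lip_free_delta x) = lip_free_delta (f x))"
    using assms(1,2) lip_free_map_exists[of _ f] by (auto intro!: lip_free_map_unique)
  from theI'[OF this]
  show "Vector_Spaces.linear lip_free_scale lip_free_scale (blinfun_apply T)"
    and "blinfun_apply T (lip_free_delta x) = lip_free_delta (f x)"
    unfolding T_def lip_free_map_def by auto
qed

section \<open>Invariant subspaces\<close>

definition nontrivial_invariant_subspace ::
  "('k::field \<Rightarrow> 'v::real_normed_vector \<Rightarrow> 'v) \<Rightarrow> ('v \<Rightarrow> 'v) \<Rightarrow> 'v set \<Rightarrow> bool" where
  "nontrivial_invariant_subspace smul T S \<longleftrightarrow>
     module.subspace smul S \<and> closed S \<and> {0} \<subset> S \<and> S \<subset> UNIV \<and> T ` S \<subseteq> S"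

end

theory Submission
  imports Defs
begin

text \<open>
  If a closed set \<open>A\<close> with \<open>0 \<in> A\<close>, \<open>A \<noteq> {0}\<close>, \<open>A \<noteq> M\<close> is mapped into itself by \<open>f\<close>, then the closed
  span of \<open>\<delta>(A)\<close> is invariant, and the distance to \<open>A\<close> separates it from \<open>\<F>(M)\<close>. Suppose that
  there is no such \<open>A\<close>. Then no point other than \<open>0\<close> is mapped to \<open>0\<close>, as its orbit would be a finite
  invariant set, and the orbits of all other points are dense. If \<open>0\<close> were not isolated, then
  there would be a compact ball \<open>K\<close> without \<open>0\<close>. The time of first return to \<open>K\<close> is bounded on \<open>K\<close> by
  compactness, so finitely many images of \<open>K\<close> form a compact invariant set without \<open>0\<close>, which
  together with \<open>0\<close> must be all of \<open>M\<close>; so \<open>0\<close> is isolated after all. Then the indicator function of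
  \<open>M - {0}\<close> is Lipschitz and invariant under composition with \<open>f\<close>, and the differences
  \<open>\<delta>(x) - \<delta>(y)\<close> with \<open>x, y \<noteq> 0\<close> span an invariant subspace in its kernel.
\<close>

section \<open>Maps without proper closed invariant sets\<close>

context
  fixes f :: "'a::metric_space \<Rightarrow> 'a" and p :: 'a
  assumes cont: "continuous_on UNIV f" and fixed: "f p = p"
    and irreducible: "\<And>A. closed A \<Longrightarrow> p \<in> A \<Longrightarrow> f ` A \<subseteq> A \<Longrightarrow> A = {p} \<or> A = UNIV"
begin

section \<open>Orbits under iteration\<close>

lemma continuous_on_funpow: "continuous_on A (f ^^ n)"
proof (induction n)
  case (Suc n)
  then show ?case
    using continuous_on_compose[OF Suc continuous_on_subset[OF cont subset_UNIV]] by simp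
qed (simp add: id_def)

text \<open>An orbit segment from \<open>x\<close> to \<open>p\<close> would be finite, hence
  closed, and invariant. It contains \<open>x\<close>, so it is not \<open>{p}\<close>, and it
  cannot exhaust an infinite space.\<close>

lemma funpow_ne_fixed_point:
  assumes "infinite (UNIV :: 'a set)" "x \<noteq> p"
  shows "(f ^^ n) x \<noteq> p"
proof
  assume n: "(f ^^ n) x = p"
  let ?A = "(\<lambda>k. (f ^^ k) x) ` {..n}"
  have "f ` ?A \<subseteq> ?A"
  proof (clarsimp)
    fix k assume "k \<le> n"
    show "f ((f ^^ k) x) \<in> ?A"
    proof (cases "k = n")
      case True
      then have "f ((f ^^ k) x) = (f ^^ n) x" using n fixed by simp
      then show ?thesis by blast
    next
      case False
      then show ?thesis using \<open>k \<le> n\<close> by (intro image_eqI[of _ _ "Suc k"]) auto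
    qed
  qed
  moreover have "p \<in> ?A" using n by auto
  moreover have "x \<in> ?A" by (intro image_eqI[of _ _ 0]) auto
  moreover have "finite ?A" by simp
  ultimately show False using irreducible[of ?A] assms finite_imp_closed by (metis singletonD)
qed

text \<open>By irreducibility, the orbit of \<open>x\<close> together with \<open>p\<close> is
  dense. As \<open>p\<close> lies outside \<open>U\<close>, the visit to \<open>U\<close> is made by
  the orbit itself.\<close>

lemma orbit_visits_open:
  assumes "x \<noteq> p" "open U" "U \<noteq> {}" "p \<notin> U"
  shows "\<exists>n. (f ^^ n) x \<in> U"
proof -
  let ?O = "insert p (range (\<lambda>n. (f ^^ n) x))"
  have "f ` ?O \<subseteq> ?O"
    using fixed by (auto intro: range_eqI[of _ _ "Suc _"])
  then have "f ` closure ?O \<subseteq> closure ?O"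
    using closure_subset[of ?O]
    by (intro image_closure_subset continuous_on_subset[OF cont subset_UNIV]) auto
  moreover have "x \<in> closure ?O" "p \<in> closure ?O"
    using closure_subset[of ?O] rangeI[of "\<lambda>n. (f ^^ n) x" 0] by auto
  ultimately have "closure ?O = UNIV" using irreducible[of "closure ?O"] assms(1) by auto
  then have "U \<inter> ?O \<noteq> {}" using open_Int_closure_eq_empty[OF assms(2), of ?O] assms(3) by auto
  then show ?thesis using assms(4) by auto
qed

section \<open>Return times to a compact ball\<close>

lemma fixed_point_isolated_if_compact_ball:
  fixes z :: 'a
  assumes inf: "infinite (UNIV :: 'a set)" and "r > 0"
    and K: "compact (cball z r)" and p: "p \<notin> cball z r"
  shows "\<exists>e>0. ball p e = {p}"
proof -
  let ?K = "cball z r" and ?U = "ball z r"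
  \<comment> \<open>Starting the orbit at \<open>f x\<close> makes the return time positive. The
    target is the open ball so that the preimages form an open cover.\<close>
  have "\<exists>n. (f ^^ Suc n) x \<in> ?U" if "x \<in> ?K" for x
  proof -
    have "x \<noteq> p" using that p by auto
    then have "f x \<noteq> p" using funpow_ne_fixed_point[OF inf, of x 1] by simp
    moreover have "?U \<noteq> {}" "p \<notin> ?U" using \<open>r > 0\<close> p by auto
    ultimately obtain n where "(f ^^ n) (f x) \<in> ?U" using orbit_visits_open[OF _ open_ball] by blast
    then show ?thesis by (metis comp_apply funpow_Suc_right)
  qed
  then have cover: "?K \<subseteq> (\<Union>n. (f ^^ Suc n) -` ?U)" by blast
  have "open ((f ^^ Suc n) -` ?U)" for n
    by (intro open_vimage open_ball continuous_on_funpow)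
  from compactE_image[OF K this cover]
  obtain I where I: "finite I" "?K \<subseteq> (\<Union>n\<in>I. (f ^^ Suc n) -` ?U)" by metis
  \<comment> \<open>Inserting 0 makes \<open>Max\<close> meaningful for empty \<open>I\<close>;
    \<open>Suc\<close> matches the exponents \<open>Suc n\<close> of the cover.\<close>
  define N where "N = Suc (Max (insert 0 I))"
  have return: "\<exists>n. 0 < n \<and> n \<le> N \<and> (f ^^ n) x \<in> ?K" if x: "x \<in> ?K" for x
  proof -
    obtain n where n: "n \<in> I" "(f ^^ Suc n) x \<in> ?U" using I(2) x by blast
    have "Suc n \<le> N" unfolding N_def using I(1) n(1) by simp
    with n(2) show ?thesis using ball_subset_cball by blast
  qed
  define L where "L = (\<Union>k\<le>N. (f ^^ k) ` ?K)"
  have "compact L" unfolding L_def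
    by (intro compact_UN compact_continuous_image K continuous_on_funpow) auto
  have fL: "f ` L \<subseteq> L"
  proof
    fix y assume "y \<in> f ` L"
    then obtain k x where k: "k \<le> N" "x \<in> ?K" "y = (f ^^ Suc k) x"
      unfolding L_def by auto
    show "y \<in> L"
    proof (cases "Suc k \<le> N")
      case True
      then show ?thesis using k unfolding L_def by blast
    next
      case False
      obtain n where n: "0 < n" "n \<le> N" "(f ^^ n) x \<in> ?K" using return[OF k(2)] by blast
      \<comment> \<open>Replacing \<open>x\<close> by its return \<open>(f ^^ n) x\<close> in the
        ball shortens the exponent by \<open>n\<close>, which is at least 1, so it drops back to at
        most \<open>N\<close>.\<close>
      have "Suc k = (Suc k - n) + n" using k(1) n False by simp
      then have "y = (f ^^ (Suc k - n)) ((f ^^ n) x)"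
        using k(3) by (metis comp_apply funpow_add)
      moreover have "Suc k - n \<le> N" using k(1) n by simp
      ultimately show ?thesis using n(3) unfolding L_def by blast
    qed
  qed
  have "p \<notin> L"
  proof
    assume "p \<in> L"
    then obtain k x where "x \<in> ?K" "(f ^^ k) x = p" unfolding L_def by auto
    moreover from this have "x \<noteq> p" using p by auto
    ultimately show False using funpow_ne_fixed_point[OF inf] by blast
  qed
  have "z \<in> L" unfolding L_def using \<open>r > 0\<close> by (auto intro!: bexI[of _ 0])
  have "f ` insert p L \<subseteq> insert p L" using fL fixed by auto
  then have "insert p L = UNIV"
    using irreducible[of "insert p L"] \<open>z \<in> L\<close> \<open>p \<notin> L\<close> \<open>compact L\<close>
    by (auto simp: compact_imp_closed)
  then have "- L = {p}" using \<open>p \<notin> L\<close> by auto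
  moreover have "open (- L)" using \<open>compact L\<close> by (simp add: compact_imp_closed open_Compl)
  ultimately obtain e where "e > 0" "ball p e \<subseteq> {p}"
    using openE[of "- L" p] by auto
  then show ?thesis by (auto intro!: exI[of _ e])
qed

text \<open>The given ball may contain \<open>p\<close>. Were \<open>p\<close> not isolated, a
  smaller ball inside it would avoid \<open>p\<close>, contradicting the previous lemma.\<close>

lemma fixed_point_isolated:
  fixes z :: 'a
  assumes inf: "infinite (UNIV :: 'a set)" and "e > 0" and K: "compact (cball z e)"
  shows "\<exists>e>0. ball p e = {p}"
proof (rule ccontr)
  assume not: "\<not> ?thesis"
  have "\<exists>y. y \<noteq> p \<and> dist z y < e"
  proof (cases "z = p")
    case True
    from not \<open>e > 0\<close> have "ball p e \<noteq> {p}" by auto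
    moreover have "p \<in> ball p e" using \<open>e > 0\<close> by simp
    ultimately obtain y where "y \<in> ball p e" "y \<noteq> p" by blast
    then show ?thesis using True by auto
  qed (use \<open>e > 0\<close> in auto)
  then obtain y where y: "y \<noteq> p" "dist z y < e" by blast
  \<comment> \<open>The first bound keeps the new ball inside the old one; the second keeps
    \<open>p\<close> out, halved because the ball is closed.\<close>
  define r where "r = min (e - dist z y) (dist y p / 2)"
  have r: "r > 0" "r \<le> e - dist z y" "r \<le> dist y p / 2" using y unfolding r_def
    by (simp_all only: min.cobounded1 min.cobounded2) simp
  have "cball y r \<subseteq> cball z e"
  proof
    fix w assume "w \<in> cball y r"
    then show "w \<in> cball z e" using r dist_triangle[of z w y] by simp
  qed
  then have "compact (cball y r)"
    using compact_Int_closed[OF K closed_cball, of y r] by (simp add: Int_absorb1)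
  moreover have "dist y p > 0" using y by simp
  then have "p \<notin> cball y r" using r by auto
  ultimately show False
    using fixed_point_isolated_if_compact_ball[OF inf r(1)] not by blast
qed

end

section \<open>Invariant subspaces spanned by finitely supported functionals\<close>

lemma bounded_linear_Rep_lip_free: "bounded_linear Rep_lip_free"
  by (rule bounded_linear_intro[of _ 1])
    (simp_all add: plus_lip_free.rep_eq scaleR_lip_free.rep_eq norm_lip_free.rep_eq)

lemma bounded_linear_lip_free_scale:
  "bounded_linear
    (lip_free_scale c :: ('a::{metric_space,zero}, 'b::real_normed_field) lip_free \<Rightarrow> _)"
proof (rule bounded_linear_intro)
  interpret s: bounded_linear "functional_scale c" by (rule bounded_linear_functional_scale)
  fix \<mu> \<nu> :: "('a, 'b) lip_free" and r :: real
  show "lip_free_scale c (\<mu> + \<nu>) = lip_free_scale c \<mu> + lip_free_scale c \<nu>"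
    by (rule lip_free.scale_right_distrib)
  show "lip_free_scale c (r *\<^sub>R \<mu>) = r *\<^sub>R lip_free_scale c \<mu>"
    by (simp add: Rep_lip_free_inject[symmetric] lip_free_scale.rep_eq scaleR_lip_free.rep_eq s.scaleR)
  show "norm (lip_free_scale c \<mu>) \<le> norm \<mu> * norm (blinfun_mult_right c)"
    using norm_blinfun_compose[of "blinfun_mult_right c" "Rep_lip_free \<mu>"]
    by (simp add: norm_lip_free.rep_eq lip_free_scale.rep_eq functional_scale_def mult.commute)
qed

lemma lip_free_subspace_closure:
  assumes "lip_free.subspace S"
  shows "lip_free.subspace (closure S)"
proof (rule lip_free.subspaceI)
  show "0 \<in> closure S" using lip_free.subspace_0[OF assms] closure_subset by blast
next
  fix x y assume "x \<in> closure S" "y \<in> closure S"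
  then obtain u v where "\<And>n. u n \<in> S" "u \<longlonglongrightarrow> x" "\<And>n. v n \<in> S" "v \<longlonglongrightarrow> y"
    unfolding closure_sequential by auto
  then show "x + y \<in> closure S"
    unfolding closure_sequential using lip_free.subspace_add[OF assms]
    by (intro exI[of _ "\<lambda>n. u n + v n"]) (auto intro: tendsto_add)
next
  fix c x assume "x \<in> closure S"
  then show "lip_free_scale c x \<in> closure S"
    using image_closure_subset[of S "lip_free_scale c" "closure S"]
      lip_free.subspace_scale[OF assms] closure_subset[of S]
    by (auto intro!: linear_continuous_on bounded_linear_lip_free_scale)
qed

text \<open>Invariance and vanishing at \<open>\<phi>\<close> pass from \<open>G\<close> to its span
  by linearity and to the closure by continuity. Thus \<open>\<nu>\<close> stays outside, while
  \<open>g\<close> makes the subspace nonzero.\<close>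

lemma nontrivial_invariant_closure_span:
  fixes G :: "('a::{metric_space,zero}, 'k::real_normed_field) lip_free set"
    and T :: "('a, 'k) lip_free \<Rightarrow>\<^sub>L ('a, 'k) lip_free"
  assumes T: "Vector_Spaces.linear lip_free_scale lip_free_scale (blinfun_apply T)"
    and TG: "blinfun_apply T ` G \<subseteq> G"
    and g: "g \<in> G" "g \<noteq> 0"
    and vanish: "\<And>\<mu>. \<mu> \<in> G \<Longrightarrow> blinfun_apply (Rep_lip_free \<mu>) \<phi> = 0"
    and \<nu>: "blinfun_apply (Rep_lip_free \<nu>) \<phi> \<noteq> 0"
  shows "nontrivial_invariant_subspace lip_free_scale (blinfun_apply T) (closure (lip_free.span G))"
proof -
  interpret T: Vector_Spaces.linear lip_free_scale lip_free_scale "blinfun_apply T" by fact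
  let ?S = "lip_free.span G"
  have "lip_free.subspace {\<mu>. blinfun_apply T \<mu> \<in> ?S}"
    by (rule lip_free.subspaceI)
      (auto simp: T.scale blinfun.bilinear_simps
        lip_free.span_zero lip_free.span_add lip_free.span_scale)
  then have "?S \<subseteq> {\<mu>. blinfun_apply T \<mu> \<in> ?S}"
    using TG by (intro lip_free.span_minimal) (auto intro: lip_free.span_base)
  then have inv: "blinfun_apply T ` closure ?S \<subseteq> closure ?S"
    using closure_subset[of ?S]
    by (intro image_closure_subset) (auto intro!: continuous_intros)
  let ?Z = "{\<mu>. blinfun_apply (Rep_lip_free \<mu>) \<phi> = 0}"
  have "lip_free.subspace ?Z"
    by (rule lip_free.subspaceI)
      (auto simp: zero_lip_free.rep_eq plus_lip_free.rep_eq lip_free_scale.rep_eq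
        blinfun.bilinear_simps)
  moreover have "closed ?Z"
    by (intro closed_Collect_eq continuous_intros linear_continuous_on[OF bounded_linear_Rep_lip_free])
  ultimately have "closure ?S \<subseteq> ?Z"
    using vanish by (intro closure_minimal lip_free.span_minimal) auto
  then have "\<nu> \<notin> closure ?S" using \<nu> by auto
  moreover have "g \<in> closure ?S" using g closure_subset[of ?S] lip_free.span_base by blast
  moreover have sub: "lip_free.subspace (closure ?S)"
    by (intro lip_free_subspace_closure lip_free.subspace_span)
  ultimately show ?thesis
    unfolding nontrivial_invariant_subspace_def
    using inv g(2) lip_free.subspace_0[OF sub] by auto
qed

section \<open>Test functions for the evaluation functionals\<close>

lemma Rep_lip_free_delta_Lip0:
  assumes "L-lipschitz_on UNIV \<phi>" "\<phi> 0 = 0"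
  shows "blinfun_apply (Rep_lip_free (lip_free_delta x)) (Lip0 \<phi>) = \<phi> x"
  using assms by (subst lip_free_delta.rep_eq, subst lip0_eval.rep_eq, subst Lip0_inverse) auto

lemma lip_free_delta_0: "lip_free_delta 0 = 0"
  by transfer (auto intro!: blinfun_eqI simp: lip0_eval.rep_eq)

lemma inj_lip_free_delta:
  "inj (lip_free_delta :: 'a::{metric_space,zero} \<Rightarrow> ('a, 'k::real_normed_field) lip_free)"
proof (rule injI)
  fix x y :: 'a
  assume eq: "(lip_free_delta x :: ('a, 'k) lip_free) = lip_free_delta y"
  \<comment> \<open>The distance to \<open>y\<close>, shifted to vanish at 0; its values at
    \<open>x\<close> and \<open>y\<close> differ by \<open>dist x y\<close>.\<close>
  let ?\<phi> = "\<lambda>z. of_real (dist z y - dist 0 y) :: 'k"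
  have "1-lipschitz_on UNIV ?\<phi>"
    by (rule lipschitz_onI)
      (use abs_dist_diff_le[of _ y] in \<open>auto simp: dist_real_def dist_commute simp del: of_real_diff\<close>)
  note pair = Rep_lip_free_delta_Lip0[OF this]
  have "?\<phi> x = ?\<phi> y" using pair[of x] pair[of y] eq by simp
  then show "x = y" by simp
qed

section \<open>The two sources of invariant subspaces\<close>

lemma invariant_subspace_of_invariant_set:
  fixes f :: "'a::{metric_space,zero} \<Rightarrow> 'a"
  assumes f: "\<exists>L. L-lipschitz_on UNIV f" "f 0 = 0"
    and A: "closed A" "0 \<in> A" "f ` A \<subseteq> A" "A \<noteq> {0}" "A \<noteq> UNIV"
  shows "\<exists>S :: ('a, 'k::real_normed_field) lip_free set.
    nontrivial_invariant_subspace lip_free_scale (blinfun_apply (lip_free_map f)) S"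
proof -
  let ?\<phi> = "\<lambda>x. of_real (infdist x A) :: 'k"
  have lip: "1-lipschitz_on UNIV ?\<phi>"
    by (rule lipschitz_onI) (auto simp: dist_real_def infdist_triangle_abs)
  note pair = Rep_lip_free_delta_Lip0[OF lip]
  obtain x where x: "x \<in> A" "x \<noteq> 0" using A by blast
  obtain y where "y \<notin> A" using A by blast
  \<comment> \<open>Closedness of \<open>A\<close> is what makes the distance to \<open>A\<close>
    positive at every outside point.\<close>
  then have y: "infdist y A \<noteq> 0" using A in_closed_iff_infdist_zero[of A y] by auto
  have "nontrivial_invariant_subspace lip_free_scale (blinfun_apply (lip_free_map f))
    (closure (lip_free.span (lip_free_delta ` A)) :: ('a, 'k) lip_free set)"
  proof (rule nontrivial_invariant_closure_span)
    show "(lip_free_delta x :: ('a, 'k) lip_free) \<noteq> 0"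
      using x inj_lip_free_delta[THEN injD, of x 0] by (auto simp: lip_free_delta_0)
    show "blinfun_apply (Rep_lip_free (lip_free_delta y)) (Lip0 ?\<phi>) \<noteq> 0"
      using y A by (subst pair) auto
    show "blinfun_apply (Rep_lip_free \<mu>) (Lip0 ?\<phi>) = 0" if "\<mu> \<in> lip_free_delta ` A" for \<mu>
      using that A by (auto simp: pair)
    show "blinfun_apply (lip_free_map f) ` lip_free_delta ` A \<subseteq> lip_free_delta ` A"
      using A(3) by (auto simp: lip_free_map(2)[OF f])
  qed (use x in \<open>auto intro: lip_free_map(1)[OF f]\<close>)
  then show ?thesis by blast
qed

lemma invariant_subspace_of_isolated_zero:
  fixes f :: "'a::{metric_space,zero} \<Rightarrow> 'a"
  assumes f: "\<exists>L. L-lipschitz_on UNIV f" "f 0 = 0" "\<And>x. x \<noteq> 0 \<Longrightarrow> f x \<noteq> 0"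
    and e: "e > 0" "ball 0 e = {0 :: 'a}" and inf: "infinite (UNIV :: 'a set)"
  shows "\<exists>S :: ('a, 'k::real_normed_field) lip_free set.
    nontrivial_invariant_subspace lip_free_scale (blinfun_apply (lip_free_map f)) S"
proof -
  let ?\<phi> = "\<lambda>x :: 'a. if x = 0 then 0 else 1 :: 'k"
  have e_le: "e \<le> dist 0 x" if "x \<noteq> 0" for x :: 'a
    using e(2) that by (metis linorder_not_less mem_ball singletonD)
  have lip: "(1/e)-lipschitz_on UNIV ?\<phi>"
    \<comment> \<open>Values differ only between 0 and a nonzero point, and such a pair is at least
      \<open>e\<close> apart.\<close>
    using e(1) e_le by (intro lipschitz_onI) (auto simp: divide_simps dist_commute)
  note pair = Rep_lip_free_delta_Lip0[OF lip]
  have "infinite (UNIV - {0 :: 'a})" using inf by simp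
  then obtain x :: 'a where x: "x \<noteq> 0" by (metis Diff_iff finite.emptyI singletonI ex_in_conv)
  have "infinite (UNIV - {0, x})" using inf by simp
  then obtain y where y: "y \<noteq> 0" "y \<noteq> x"
    by (metis Diff_iff finite.emptyI insertCI ex_in_conv)
  \<comment> \<open>This set is invariant since \<open>f\<close> keeps nonzero points nonzero. The
    distinct points \<open>x\<close> and \<open>y\<close> give it a nonzero element.\<close>
  let ?G = "{lip_free_delta u - lip_free_delta v | u v. u \<noteq> 0 \<and> v \<noteq> 0} :: ('a, 'k) lip_free set"
  have "nontrivial_invariant_subspace lip_free_scale (blinfun_apply (lip_free_map f))
    (closure (lip_free.span ?G))"
  proof (rule nontrivial_invariant_closure_span)
    show "lip_free_delta x - lip_free_delta y \<in> ?G" using x y by blast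
    show "(lip_free_delta x - lip_free_delta y :: ('a, 'k) lip_free) \<noteq> 0"
      using y inj_lip_free_delta[THEN injD, of x y] by auto
    show "blinfun_apply (Rep_lip_free (lip_free_delta x)) (Lip0 ?\<phi>) \<noteq> 0"
      using x by (subst pair) auto
    show "blinfun_apply (Rep_lip_free \<mu>) (Lip0 ?\<phi>) = 0" if "\<mu> \<in> ?G" for \<mu>
      using that by (auto simp: pair minus_lip_free.rep_eq blinfun.bilinear_simps)
    show "blinfun_apply (lip_free_map f) ` ?G \<subseteq> ?G"
      using f(3) by (fastforce simp: blinfun.diff_right lip_free_map(2)[OF f(1,2)])
  qed (intro lip_free_map(1)[OF f(1,2)])
  then show ?thesis by blast
qed

text \<open>The scalar field stays arbitrary, so the real and the complex case are both
  instances.\<close>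

lemma invariant_subspace_of_compact_cball:
  fixes f :: "'a::{metric_space,zero} \<Rightarrow> 'a" and z :: 'a
  assumes inf: "infinite (UNIV :: 'a set)" and K: "\<epsilon> > 0" "compact (cball z \<epsilon>)"
    and f: "\<exists>L. L-lipschitz_on UNIV f" "f 0 = 0"
  shows "\<exists>S :: ('a, 'k::real_normed_field) lip_free set.
    nontrivial_invariant_subspace lip_free_scale (blinfun_apply (lip_free_map f)) S"
proof (cases "\<exists>A. closed A \<and> 0 \<in> A \<and> f ` A \<subseteq> A \<and> A \<noteq> {0} \<and> A \<noteq> UNIV")
  case True
  then show ?thesis using invariant_subspace_of_invariant_set[OF f] by blast
next
  case False
  then have irred: "A = {0} \<or> A = UNIV" if "closed A" "0 \<in> A" "f ` A \<subseteq> A" for A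
    using that by blast
  have cont: "continuous_on UNIV f" using f(1) lipschitz_on_continuous_on by blast
  have "\<exists>e>0. ball 0 e = {0 :: 'a}"
    by (rule fixed_point_isolated[OF cont f(2) _ inf K]) (rule irred)
  then obtain e where e: "e > 0" "ball 0 e = {0 :: 'a}" by blast
  have "f x \<noteq> 0" if "x \<noteq> 0" for x
  proof -
    have "(f ^^ 1) x \<noteq> 0"
      by (rule funpow_ne_fixed_point[OF cont f(2) _ inf that]) (rule irred)
    then show ?thesis by simp
  qed
  then show ?thesis using invariant_subspace_of_isolated_zero[OF f _ e inf] by blast
qed

theorem theorem3p5:
  fixes xbar :: "'a::{metric_space,zero}" and \<epsilon> :: real
  assumes "infinite (UNIV :: 'a set)"
    and "\<epsilon> > 0"
    and "compact (cball xbar \<epsilon>)"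
  shows "\<forall>f :: 'a \<Rightarrow> 'a. (\<exists>L. L-lipschitz_on UNIV f) \<and> f 0 = 0 \<longrightarrow>
    (\<exists>S :: ('a, real) lip_free set.
       nontrivial_invariant_subspace lip_free_scale (blinfun_apply (lip_free_map f)) S) \<and>
    (\<exists>S :: ('a, complex) lip_free set.
       nontrivial_invariant_subspace lip_free_scale (blinfun_apply (lip_free_map f)) S)"
proof (intro allI impI)
  fix f :: "'a \<Rightarrow> 'a"
  assume "(\<exists>L. L-lipschitz_on UNIV f) \<and> f 0 = 0"
  then have f: "\<exists>L. L-lipschitz_on UNIV f" "f 0 = 0" by auto
  show "(\<exists>S :: ('a, real) lip_free set.
       nontrivial_invariant_subspace lip_free_scale (blinfun_apply (lip_free_map f)) S) \<and>
    (\<exists>S :: ('a, complex) lip_free set.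
       nontrivial_invariant_subspace lip_free_scale (blinfun_apply (lip_free_map f)) S)"
    by (intro conjI invariant_subspace_of_compact_cball[OF assms f])
qed

end
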